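(* Let $T$ be a tree of order $n \geq 2$ with diameter $d$ and with $p$ pendant vertices. Let $\alpha(T)$ denote the independence number of $T$. Then $$\alpha(T) \leq \min\left\{\left\lceil\frac{2n-d-1}{2}\right\rceil, \left\lfloor\frac{2n+p-2}{3}\right\rfloor\right\}.$$
   Context: All graphs are finite and simple. A tree is a connected acyclic graph; its order is its number of vertices. The diameter of a graph is the maximum distance between two of its vertices. A pendant vertex is a vertex of degree one. The independence number of a graph is the maximum size of a set of pairwise non-adjacent vertices. *)

theory Defs
  imports Complex_Main "Graph_Theory.Graph_Theory"
begin

text \<open>
  Finite simple graphs are rendered by the locale \<open>graph\<close> of the entry Graph_Theory: finite,
  loop-free, symmetric digraphs without parallel arcs, each edge being a pair of opposite arcs.

  Pitfall: \<open>Digraph_Component.tree\<close> cannot be used here, because \<open>forest\<close> counts the closed walk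
  along an arc and back along its opposite as a cycle. A cycle of an undirected simple graph
  is a cycle of length at least three.
\<close>

definition acyclic_graph :: "('a, 'b) pre_digraph \<Rightarrow> bool" where
  "acyclic_graph G \<longleftrightarrow> \<not> (\<exists>c. pre_digraph.cycle G c \<and> length c \<ge> 3)"

definition tree_graph :: "('a, 'b) pre_digraph \<Rightarrow> bool" where
  "tree_graph G \<longleftrightarrow> graph G \<and> Digraph_Component.connected G \<and> acyclic_graph G"

text \<open>Only meaningful if \<open>v\<close> is reachable from \<open>u\<close>; below it is applied to connected graphs.\<close>

definition graph_dist :: "('a, 'b) pre_digraph \<Rightarrow> 'a \<Rightarrow> 'a \<Rightarrow> nat" where
  "graph_dist G u v = (LEAST k. \<exists>w. pre_digraph.awalk G u w v \<and> length w = k)"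

definition diameter :: "('a, 'b) pre_digraph \<Rightarrow> nat" where
  "diameter G = Max {graph_dist G u v | u v. u \<in> verts G \<and> v \<in> verts G}"

text \<open>In a \<open>graph\<close>, the arcs leaving \<open>v\<close> correspond to the edges at \<open>v\<close>.\<close>

definition pendant_verts :: "('a, 'b) pre_digraph \<Rightarrow> 'a set" where
  "pendant_verts G = {v \<in> verts G. out_degree G v = 1}"

definition independent_set :: "('a, 'b) pre_digraph \<Rightarrow> 'a set \<Rightarrow> bool" where
  "independent_set G S \<longleftrightarrow> S \<subseteq> verts G \<and> pairwise (\<lambda>u v. \<not> u \<rightarrow>\<^bsub>G\<^esub> v) S"

definition independence_number :: "('a, 'b) pre_digraph \<Rightarrow> nat" where
  "independence_number G = Max {card S | S. independent_set G S}"

end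

theory Submission
  imports Defs
begin

text \<open>
  Let \<open>S\<close> be an independent set of maximum size.

  \<^emph>\<open>First bound.\<close> Two vertices at distance \<open>d\<close> are joined by a path with \<open>d + 1\<close> vertices. Of two
  consecutive vertices at most one belongs to \<open>S\<close>, so \<open>S\<close> contains at most half of them, rounded up
  (lemma \<open>independent_inter_walk\<close>), and at most all of the \<open>n - d - 1\<close> remaining vertices.

  \<^emph>\<open>Second bound.\<close> An edge has at most one end in \<open>S\<close>, so the degrees of the vertices in \<open>S\<close> add up
  to at most the number of edges, that is, to at most \<open>n - 1\<close>. All these degrees are positive, and
  only pendant vertices have degree one; hence \<open>2 |S| - p \<le> n - 1\<close>. Moreover \<open>|S| \<le> n - 1\<close>, since
  a neighbour of a vertex in \<open>S\<close> lies outside \<open>S\<close>. The sum of the two inequalities is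
  \<open>3 |S| \<le> 2 n + p - 2\<close>.

  The edge count rests on the fact that every nonempty vertex set \<open>W\<close> of an acyclic graph has a
  vertex with at most one neighbour in \<open>W\<close> (lemma \<open>acyclic_ex_leaf_within\<close>). Removing such
  vertices one by one, each step loses at most one edge that meets \<open>S\<close>, and a single vertex has none
  (lemma \<open>acyclic_card_arcs_from_independent\<close>).
\<close>

section \<open>Arcs in finite simple graphs\<close>

lemma (in graph) ex_opposite_arc:
  assumes "e \<in> arcs G"
  obtains e' where "e' \<in> arcs G" "tail G e' = head G e" "head G e' = tail G e"
  using sym_arcs assms unfolding symmetric_conv by metis

lemma (in graph) arc_eqI:
  assumes "e \<in> arcs G" "f \<in> arcs G" "tail G e = tail G f" "head G e = head G f"
  shows "e = f"
  using assms by (intro no_multi_arcs) (auto simp: arc_to_ends_def)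

lemma independent_set_head_notin:
  assumes "graph G" "independent_set G S" "e \<in> arcs G" "tail G e \<in> S"
  shows "head G e \<notin> S"
proof -
  interpret graph G by fact
  have "(tail G e, head G e) \<in> arcs_ends G" "tail G e \<noteq> head G e"
    using assms(3) in_arcs_imp_in_arcs_ends no_loops by auto
  then show ?thesis
    using assms(2,4) by (auto simp: independent_set_def pairwise_def)
qed

lemma (in graph) connected_out_degree_pos:
  assumes "Digraph_Component.connected G" "card (verts G) \<ge> 2" "v \<in> verts G"
  shows "out_degree G v \<ge> 1"
proof -
  have "\<not> verts G \<subseteq> {v}"
    using assms(2) card_mono[of "{v}" "verts G"] by auto
  then obtain w where w: "w \<in> verts G" "w \<noteq> v" by auto
  have "v \<rightarrow>\<^sup>* w"
    using assms(1,3) w reachable_mk_symmetric_eq[OF sym_arcs]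
    by (auto simp: Digraph_Component.connected_def strongly_connected_def)
  then obtain p where p: "awalk v p w" by (auto simp: reachable_awalk)
  with w obtain e es where "p = e # es" by (cases p) (auto simp: awalk_simps)
  with p have "e \<in> out_arcs G v" by (auto simp: awalk_simps)
  then show ?thesis
    unfolding out_degree_def using finite_out_arcs[of v]
    by (metis One_nat_def Suc_leI card_gt_0_iff empty_iff)
qed

section \<open>Independent sets and shortest paths\<close>

text \<open>
  Any two consecutive vertices of the walk contribute at most one element to \<open>S\<close>, so the induction
  removes the vertices in pairs.
\<close>

lemma independent_inter_walk:
  assumes "graph G" "independent_set G S" "pre_digraph.awalk G u p v"
  shows "2 * card (S \<inter> set (pre_digraph.awalk_verts G u p)) \<le> length p + 2"
proof -
  interpret graph G by fact
  show ?thesis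
    using assms(3)
  proof (induction p arbitrary: u rule: induct_list012)
    case 1
    have "card (S \<inter> {u}) \<le> 1" by (cases "u \<in> S") auto
    then show ?case by simp
  next
    case (2 e)
    then have "tail G e \<in> S \<Longrightarrow> head G e \<notin> S"
      using independent_set_head_notin[OF assms(1,2)] by (auto simp: awalk_simps)
    then have "card (S \<inter> {tail G e, head G e}) \<le> 1"
      by (cases "tail G e \<in> S"; cases "head G e \<in> S") auto
    then show ?case by simp
  next
    case (3 e f es)
    have walk: "awalk (head G f) es v" and e: "e \<in> arcs G"
      and f: "tail G f = head G e"
      using "3.prems" by (simp_all add: awalk_Cons_iff)
    let ?R = "S \<inter> set (awalk_verts (head G f) es)"
    have "tail G e \<in> S \<Longrightarrow> head G e \<notin> S"
      using independent_set_head_notin[OF assms(1,2) e] by simp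
    then have pair: "card (S \<inter> {tail G e, head G e}) \<le> 1"
      by (cases "tail G e \<in> S"; cases "head G e \<in> S") auto
    have "S \<inter> set (awalk_verts u (e # f # es)) = (S \<inter> {tail G e, head G e}) \<union> ?R"
      using f by auto
    then have "card (S \<inter> set (awalk_verts u (e # f # es))) \<le> card (S \<inter> {tail G e, head G e}) + card ?R"
      by (simp only: card_Un_le)
    with pair "3.IH"(1)[OF walk] show ?case by simp
  qed
qed

text \<open>A shortest walk is a path, since a repeated vertex would allow a shortcut.\<close>

lemma ex_apath_graph_dist:
  assumes "graph G" "u \<rightarrow>\<^sup>*\<^bsub>G\<^esub> v"
  obtains p where "pre_digraph.apath G u p v" "length p = graph_dist G u v"
proof -
  interpret graph G by fact
  let ?P = "\<lambda>k. \<exists>w. awalk u w v \<and> length w = k"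
  have ex: "\<exists>k. ?P k" using assms(2) by (auto simp: reachable_awalk)
  have "?P (graph_dist G u v)"
    unfolding graph_dist_def by (rule LeastI_ex[OF ex])
  then obtain p where p: "awalk u p v" "length p = graph_dist G u v" by auto
  have "distinct (awalk_verts u p)"
  proof (rule ccontr)
    assume "\<not> distinct (awalk_verts u p)"
    then obtain q r s w where d: "p = q @ r @ s" "0 < length r" "awalk u q w" "awalk w s v"
      using awalk_not_distinct_decomp[OF p(1)] by blast
    then have "?P (length (q @ s))" using awalk_appendI by blast
    then have "graph_dist G u v \<le> length (q @ s)"
      unfolding graph_dist_def by (rule Least_le)
    moreover have "length p = length q + length r + length s" using d(1) by simp
    ultimately show False using d(2) p(2) by simp
  qed
  with p that show ?thesis by (auto simp: apath_def)
qed

lemma (in graph) connected_ex_apath_diameter: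
  assumes "Digraph_Component.connected G"
  obtains u p v where "apath u p v" "length p = diameter G"
proof -
  let ?D = "{graph_dist G u v | u v. u \<in> verts G \<and> v \<in> verts G}"
  have "?D = (\<lambda>(u, v). graph_dist G u v) ` (verts G \<times> verts G)" by auto
  then have "finite ?D" by simp
  moreover have "verts G \<noteq> {}"
    using assms by (auto simp: Digraph_Component.connected_def strongly_connected_def)
  then have "?D \<noteq> {}" by auto
  ultimately have "diameter G \<in> ?D"
    unfolding diameter_def by (rule Max_in)
  then obtain u v where uv: "u \<in> verts G" "v \<in> verts G" "graph_dist G u v = diameter G"
    by auto
  have "u \<rightarrow>\<^sup>* v"
    using assms uv reachable_mk_symmetric_eq[OF sym_arcs]
    by (auto simp: Digraph_Component.connected_def strongly_connected_def)
  with uv(3) that show ?thesis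
    using ex_apath_graph_dist[OF graph_axioms] by metis
qed

lemma (in graph) independent_set_card_diameter:
  assumes "Digraph_Component.connected G" "independent_set G S"
  shows "2 * card S + diameter G \<le> 2 * card (verts G)"
proof -
  obtain u p v where p: "apath u p v" "length p = diameter G"
    using connected_ex_apath_diameter[OF assms(1)] .
  let ?P = "set (awalk_verts u p)"
  have P: "awalk u p v" "?P \<subseteq> verts G" "card ?P = diameter G + 1"
    using p by (auto simp: apath_def distinct_card length_awalk_verts)
  have S: "S \<subseteq> verts G" using assms(2) by (simp add: independent_set_def)
  have "card S \<le> card ((S \<inter> ?P) \<union> (verts G - ?P))"
    using S by (intro card_mono) (auto intro: finite_subset)
  also have "\<dots> \<le> card (S \<inter> ?P) + card (verts G - ?P)"
    by (rule card_Un_le)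
  also have "card (verts G - ?P) = card (verts G) - (diameter G + 1)"
    using P by (simp add: card_Diff_subset)
  finally have "card S \<le> card (S \<inter> ?P) + (card (verts G) - (diameter G + 1))" .
  moreover have "diameter G + 1 \<le> card (verts G)"
    using P card_mono[OF finite_verts P(2)] by simp
  moreover have "2 * card (S \<inter> ?P) \<le> diameter G + 2"
    using independent_inter_walk[OF graph_axioms assms(2) P(1)] p(2) by simp
  ultimately show ?thesis by linarith
qed

section \<open>Edges of acyclic graphs\<close>

text \<open>
  The witness is an end of a longest path inside \<open>W\<close>: by maximality all its neighbours in \<open>W\<close> lie on
  that path, and a neighbour other than the next vertex of the path closes a cycle.
\<close>

lemma (in graph) acyclic_ex_leaf_within:
  assumes "acyclic_graph G" "W \<subseteq> verts G" "W \<noteq> {}"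
  obtains w where "w \<in> W"
    "\<And>e f. \<lbrakk>e \<in> arcs G; f \<in> arcs G; tail G e = w; tail G f = w; head G e \<in> W; head G f \<in> W\<rbrakk>
      \<Longrightarrow> e = f"
proof -
  let ?Q = "\<lambda>p. \<exists>u v. apath u p v \<and> set (awalk_verts u p) \<subseteq> W"
  obtain x where "x \<in> W" using assms(3) by auto
  then have "?Q []" using assms(2) by (auto simp: apath_Nil_iff)
  moreover have "\<forall>p. ?Q p \<longrightarrow> length p < Suc (card (verts G))"
    using length_apath by (auto simp: less_Suc_eq_le)
  ultimately obtain p where "?Q p" and longest: "\<And>q. ?Q q \<Longrightarrow> length q \<le> length p"
    using ex_has_greatest_nat[of ?Q "[]" length "Suc (card (verts G))"] by blast
  then obtain u v where p: "apath u p v" "set (awalk_verts u p) \<subseteq> W" by auto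
  then have walk: "awalk u p v" and dist: "distinct (awalk_verts u p)"
    by (auto simp: apath_def)
  have on_path: "head G e \<in> set (awalk_verts u p)"
    if "e \<in> arcs G" "tail G e = u" "head G e \<in> W" for e
  proof (rule ccontr)
    assume out: "head G e \<notin> set (awalk_verts u p)"
    obtain e' where e': "e' \<in> arcs G" "tail G e' = head G e" "head G e' = tail G e"
      using ex_opposite_arc[OF \<open>e \<in> arcs G\<close>] .
    with that p out have "apath (head G e) (e' # p) v" "set (awalk_verts (head G e) (e' # p)) \<subseteq> W"
      by (auto simp: apath_Cons_iff)
    then have "?Q (e' # p)" by blast
    from longest[OF this] show False by simp
  qed
  have first: "p \<noteq> [] \<and> e = hd p" if e: "e \<in> arcs G" "tail G e = u" "head G e \<in> W" for e
  proof (rule ccontr)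
    assume not_first: "\<not> (p \<noteq> [] \<and> e = hd p)"
    obtain q r where q: "p = q @ r" "awalk u q (head G e)"
      using awalk_decomp[OF walk on_path[OF e]] by blast
    have "head G e \<noteq> u" using no_loops e by metis
    with q(2) obtain f q' where f: "q = f # q'" by (cases q) (auto simp: awalk_simps)
    have "q' \<noteq> []"
    proof
      assume "q' = []"
      then have "f = e" using q(2) f e by (intro arc_eqI) (auto simp: awalk_simps)
      with not_first q(1) f show False by simp
    qed
    obtain e' where e': "e' \<in> arcs G" "tail G e' = head G e" "head G e' = tail G e"
      using ex_opposite_arc[OF e(1)] .
    have "apath u q (awlast u q)"
      using p(1) q by (simp add: apath_append_iff)
    then have "distinct (awalk_verts u q)" by (simp add: apath_def)
    then have "cycle (e' # q)"
      unfolding cycle_def using q(2) e' e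
      by (intro exI[of _ "head G e"]) (auto simp: awalk_Cons_iff)
    moreover have "length (e' # q) \<ge> 3"
      using f \<open>q' \<noteq> []\<close> by (cases q') auto
    ultimately show False using assms(1) unfolding acyclic_graph_def by blast
  qed
  have "u \<in> W" using p hd_in_awalk_verts by blast
  with first that show ?thesis by metis
qed

text \<open>
  Induction on \<open>W\<close>: take out a vertex \<open>w\<close> with at most one neighbour in \<open>W\<close>. The arcs that disappear
  leave \<open>w\<close> if \<open>w \<in> S\<close> and enter \<open>w\<close> otherwise, because \<open>S\<close> is independent; either way there is at
  most one.
\<close>

lemma (in graph) acyclic_card_arcs_from_independent:
  assumes "acyclic_graph G" "independent_set G S" "W \<subseteq> verts G" "W \<noteq> {}"
  shows "card {e \<in> arcs G. tail G e \<in> S \<inter> W \<and> head G e \<in> W} < card W"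
proof -
  have "finite W" using assms(3) finite_verts finite_subset by blast
  then show ?thesis
    using assms(3,4)
  proof (induction W rule: finite_psubset_induct)
    case (psubset W)
    let ?A = "\<lambda>W. {e \<in> arcs G. tail G e \<in> S \<inter> W \<and> head G e \<in> W}"
    obtain w where w: "w \<in> W" and unique:
      "\<And>e f. \<lbrakk>e \<in> arcs G; f \<in> arcs G; tail G e = w; tail G f = w; head G e \<in> W; head G f \<in> W\<rbrakk>
        \<Longrightarrow> e = f"
      using acyclic_ex_leaf_within[OF assms(1) psubset.prems] by blast
    have unique_in: "e = f"
      if ef: "e \<in> arcs G" "f \<in> arcs G" "head G e = w" "head G f = w"
        "tail G e \<in> W" "tail G f \<in> W" for e f
    proof -
      obtain e' where e': "e' \<in> arcs G" "tail G e' = head G e" "head G e' = tail G e"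
        using ex_opposite_arc[OF ef(1)] .
      obtain f' where f': "f' \<in> arcs G" "tail G f' = head G f" "head G f' = tail G f"
        using ex_opposite_arc[OF ef(2)] .
      have "e' = f'" using unique e' f' ef by metis
      then show ?thesis using e' f' ef by (intro arc_eqI) auto
    qed
    show ?case
    proof (cases "W = {w}")
      case True
      then have "?A W = {}" by (auto dest: no_loops)
      then show ?thesis using True by simp
    next
      case False
      let ?D = "?A W - ?A (W - {w})"
      have fin: "finite (?A X)" for X by simp
      have D: "e \<in> arcs G" "tail G e \<in> S" "tail G e \<in> W" "head G e \<in> W"
        "tail G e = w \<or> head G e = w" if "e \<in> ?D" for e
        using that by simp_all
      have head: "head G e \<notin> S" if "e \<in> ?D" for e
        by (rule independent_set_head_notin[OF graph_axioms assms(2) D(1,2)[OF that]])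
      have "e = f" if ef: "e \<in> ?D" "f \<in> ?D" for e f
      proof (cases "w \<in> S")
        case True
        then have "tail G e = w" if "e \<in> ?D" for e
          using D(5)[OF that] head[OF that] by metis
        from this[OF ef(1)] this[OF ef(2)] show ?thesis
          by (rule unique[OF D(1)[OF ef(1)] D(1)[OF ef(2)] _ _ D(4)[OF ef(1)] D(4)[OF ef(2)]])
      next
        case False
        then have "head G e = w" if "e \<in> ?D" for e
          using D(2,5)[OF that] by metis
        from this[OF ef(1)] this[OF ef(2)] show ?thesis
          by (rule unique_in[OF D(1)[OF ef(1)] D(1)[OF ef(2)] _ _ D(3)[OF ef(1)] D(3)[OF ef(2)]])
      qed
      then have "\<forall>e\<in>?D. \<forall>f\<in>?D. e = f" by (intro ballI)
      then have "card ?D \<le> Suc 0"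
        by (rule card_le_Suc0_iff_eq[OF finite_Diff[OF fin], THEN iffD2])
      moreover have "card (?A W) \<le> card (?A (W - {w})) + card ?D"
      proof -
        have "?A (W - {w}) \<union> ?D = ?A W" by blast
        then show ?thesis using card_Un_le[of "?A (W - {w})" ?D] by simp
      qed
      moreover have "card (?A (W - {w})) < card (W - {w})"
      proof (rule psubset.IH)
        show "W - {w} \<subset> W" "W - {w} \<noteq> {}" using False w by blast+
        show "W - {w} \<subseteq> verts G" using psubset.prems by blast
      qed
      moreover have "card W = Suc (card (W - {w}))"
        by (rule card.remove[OF psubset.hyps w])
      ultimately show ?thesis by linarith
    qed
  qed
qed

lemma (in graph) acyclic_sum_out_degree_independent:
  assumes "acyclic_graph G" "independent_set G S" "verts G \<noteq> {}"
  shows "(\<Sum>v\<in>S. out_degree G v) < card (verts G)"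
proof -
  have S: "S \<subseteq> verts G" "finite S"
    using assms(2) finite_subset[OF _ finite_verts] by (auto simp: independent_set_def)
  have "(\<Sum>v\<in>S. out_degree G v) = card (\<Union>v\<in>S. out_arcs G v)"
    unfolding out_degree_def using S(2) by (subst card_UN_disjoint) auto
  also have "(\<Union>v\<in>S. out_arcs G v) =
      {e \<in> arcs G. tail G e \<in> S \<inter> verts G \<and> head G e \<in> verts G}"
    using S(1) by auto
  also have "card \<dots> < card (verts G)"
    by (rule acyclic_card_arcs_from_independent[OF assms(1,2) order_refl assms(3)])
  finally show ?thesis .
qed

section \<open>Independent sets and pendant vertices\<close>

lemma tree_independent_set_card_pendant:
  assumes "tree_graph G" "card (verts G) \<ge> 2" "independent_set G S"
  shows "3 * card S + 2 \<le> 2 * card (verts G) + card (pendant_verts G)"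
proof -
  interpret graph G using assms(1) by (simp add: tree_graph_def)
  have conn: "Digraph_Component.connected G" and acyc: "acyclic_graph G"
    using assms(1) by (auto simp: tree_graph_def)
  have S: "S \<subseteq> verts G" "finite S"
    using assms(3) finite_subset[OF _ finite_verts] by (auto simp: independent_set_def)
  have ne: "verts G \<noteq> {}" using assms(2) by auto
  have deg: "out_degree G v \<ge> 1" if "v \<in> verts G" for v
    using connected_out_degree_pos[OF conn assms(2) that] .

  have "S \<noteq> verts G"
  proof
    assume "S = verts G"
    obtain v where v: "v \<in> verts G" using ne by auto
    then have "out_arcs G v \<noteq> {}" using deg[OF v] by (auto simp: out_degree_def)
    then obtain e where "e \<in> arcs G" by auto
    with \<open>S = verts G\<close> show False
      using independent_set_head_notin[OF graph_axioms assms(3)] by auto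
  qed
  then have proper: "card S < card (verts G)"
    using S by (intro psubset_card_mono) auto

  let ?P = "pendant_verts G"
  have "2 * card S = (\<Sum>v\<in>S. 2)" by simp
  also have "\<dots> \<le> (\<Sum>v\<in>S. out_degree G v + (if v \<in> ?P then 1 else 0))"
  proof (rule sum_mono)
    fix v assume "v \<in> S"
    then show "2 \<le> out_degree G v + (if v \<in> ?P then 1 else 0)"
      using deg[of v] S by (auto simp: pendant_verts_def)
  qed
  also have "\<dots> = (\<Sum>v\<in>S. out_degree G v) + card (S \<inter> ?P)"
    using S(2) by (simp add: sum.distrib sum.If_cases Int_def)
  finally have "2 * card S \<le> (\<Sum>v\<in>S. out_degree G v) + card (S \<inter> ?P)" .
  moreover have "card (S \<inter> ?P) \<le> card ?P"
    by (rule card_mono) (auto simp: pendant_verts_def)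
  ultimately show ?thesis
    using acyclic_sum_out_degree_independent[OF acyc assms(3) ne] proper by linarith
qed

lemma (in graph) ex_maximum_independent_set:
  obtains S where "independent_set G S" "card S = independence_number G"
proof -
  let ?C = "{card S | S. independent_set G S}"
  have "?C \<subseteq> card ` Pow (verts G)" by (auto simp: independent_set_def)
  then have "finite ?C" by (rule finite_subset) simp
  moreover have "independent_set G {}" by (simp add: independent_set_def)
  then have "?C \<noteq> {}" by blast
  ultimately have "independence_number G \<in> ?C"
    unfolding independence_number_def by (rule Max_in)
  with that show ?thesis by auto
qed

section \<open>The bound on the independence number of a tree\<close>

theorem corollary4p3:
  fixes T :: "('a, 'b) pre_digraph" and n d p :: nat
  assumes "tree_graph T"
    and "card (verts T) = n" and "n \<ge> 2"
    and "diameter T = d"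
    and "card (pendant_verts T) = p"
  shows "int (independence_number T) \<le>
    min \<lceil>(2 * real n - real d - 1) / 2\<rceil> \<lfloor>(2 * real n + real p - 2) / 3\<rfloor>"
proof -
  interpret graph T using assms(1) by (simp add: tree_graph_def)
  have conn: "Digraph_Component.connected T" using assms(1) by (simp add: tree_graph_def)
  obtain S where S: "independent_set T S" "card S = independence_number T"
    using ex_maximum_independent_set .
  let ?a = "independence_number T"
  have "2 * ?a + d \<le> 2 * n"
    using independent_set_card_diameter[OF conn S(1)] S(2) assms by simp
  then have "2 * real ?a + real d \<le> 2 * real n" by linarith
  \<comment> \<open>An integer that exceeds a real number by less than one is at most its ceiling.\<close>
  then have "int ?a \<le> \<lceil>(2 * real n - real d - 1) / 2\<rceil>"
    by (simp add: le_ceiling_iff)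
  moreover
  have "3 * ?a + 2 \<le> 2 * n + p"
    using tree_independent_set_card_pendant[OF assms(1) _ S(1)] S(2) assms by simp
  then have "3 * real ?a + 2 \<le> 2 * real n + real p" by linarith
  then have "int ?a \<le> \<lfloor>(2 * real n + real p - 2) / 3\<rfloor>"
    by (simp add: le_floor_iff)
  ultimately show ?thesis by simp
qed

end
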